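(* For every simply typed $\lambda$-term $M$: (1) if $*;M^{\mathrm n}\to^* u_*$ in the ptq-calculus, then $M\to^*\lfloor u_*\rfloor$ in the Call-by-Name $\lambda$-calculus; (2) if $M^{\mathrm v}\,*\to^*u_*$ in the ptq-calculus, then $M\to^*\lfloor u_*\rfloor$ in the Call-by-Value $\lambda$-calculus.
   Context: Call-by-Name and Call-by-Value $\lambda$-calculi (lazy, no reduction under $\lambda$; a value $V$ is a variable or an abstraction). CbN one-step: $(\lambda x.M)N\to M[N/x]$, and $M\to M_1$ implies $MN\to M_1N$. CbV one-step (argument evaluated first): $(\lambda x.M)V\to M[V/x]$ for $V$ a value; $N\to N_1$ implies $MN\to MN_1$; $M\to M_1$ implies $MV\to M_1V$ for $V$ a value. $\to^*$ is reflexive–transitive closure. ptq-calculus: p-variables (identified with $\lambda$-variables), a t-variable $k$, a constant $*$; p-terms $p::=x\mid\lambda\langle x,k\rangle.u\mid\lambda k.u$; t-terms $t::=*\mid k\mid\langle p,t\rangle\mid\lambda x.u$; q-terms $q::=\overline{\lambda}k.u$; e-terms $u::=t;p\mid q\,t$; binders $\lambda\langle x,k\rangle$ (binds $x,k$), $\lambda k,\overline\lambda k$ (bind $k$), $\lambda x$ (binds $x$); terms modulo $\alpha$-conversion. For $u$ with $k$ free, $u_*:=u[*/k]$. Reduction (on t-closed e-terms, top level only): $*;\lambda k.u\to u[*/k]$; $\langle p,t_*\rangle;\lambda k.u\to u[\langle p,t_*\rangle/k]$; $\langle p,t_*\rangle;\lambda\langle x,k\rangle.u\to u[p/x,t_*/k]$;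 $(\lambda x.u_* );p\to u_*[p/x]$; $(\overline\lambda k.u)\,t_*\to u[t_*/k]$. Readback into $\lambda$-terms possibly containing a hole constant $\Box$, with $M\cdot N:=M[N/\Box]$: $\lfloor *\rfloor=\Box$; $\lfloor x\rfloor=x$; $\lfloor\langle p,t_*\rangle\rfloor=\lfloor t_*\rfloor\cdot(\Box\,\lfloor p\rfloor)$; $\lfloor\lambda\langle x,k\rangle.u\rfloor=\lambda x.\lfloor u_*\rfloor$; $\lfloor\lambda x.u_*\rfloor=\lfloor u_*\rfloor[\Box/x]$; $\lfloor\lambda k.u\rfloor=\lfloor u_*\rfloor$; $\lfloor\overline\lambda k.u\rfloor=\lfloor u_*\rfloor$; $\lfloor t_*;p\rfloor=\lfloor t_*\rfloor\cdot\lfloor p\rfloor$; $\lfloor q\,t_*\rfloor=\lfloor t_*\rfloor\cdot\lfloor q\rfloor$. Translations: $x^{\mathrm n}=x$, $(\lambda x.M)^{\mathrm n}=\lambda\langle x,k\rangle.k;M^{\mathrm n}$, $(MN)^{\mathrm n}=\lambda k.\langle N^{\mathrm n},k\rangle;M^{\mathrm n}$; $x^{\mathrm v}=\overline\lambda k.k;x$, $(\lambda x.M)^{\mathrm v}=\overline\lambda k.k;(\lambda\langle x,k\rangle.M^{\mathrm v}k)$, $(MN)^{\mathrm v}=\overline\lambda k.N^{\mathrm v}(\lambda x.M^{\mathrm v}\langle x,k\rangle)$ ($x$ fresh). *)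

theory Defs
  imports Main
begin

text \<open>Terms modulo \<open>\<alpha>\<close>-conversion are represented with de Bruijn indices. The constructor
  \<open>Hole\<close> is the hole constant of readback; the simply typed terms below do not contain it.\<close>

datatype lam = Var nat | App lam lam | Lam lam | Hole

primrec lift :: "lam \<Rightarrow> nat \<Rightarrow> lam" where
  "lift (Var i) c = (if i < c then Var i else Var (Suc i))"
| "lift (App M N) c = App (lift M c) (lift N c)"
| "lift (Lam M) c = Lam (lift M (Suc c))"
| "lift Hole c = Hole"

primrec subst :: "lam \<Rightarrow> nat \<Rightarrow> lam \<Rightarrow> lam" where
  "subst (Var i) c P = (if i < c then Var i else if i = c then P else Var (i - 1))"
| "subst (App M N) c P = App (subst M c P) (subst N c P)"
| "subst (Lam M) c P = Lam (subst M (Suc c) (lift P 0))"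
| "subst Hole c P = Hole"

text \<open>\<open>M \<cdot> N\<close> is the capture-avoiding substitution of \<open>N\<close> for the hole in \<open>M\<close>.\<close>

primrec plug :: "lam \<Rightarrow> lam \<Rightarrow> lam" (infixl \<open>\<cdot>\<close> 70) where
  "Var i \<cdot> P = Var i"
| "App M N \<cdot> P = App (M \<cdot> P) (N \<cdot> P)"
| "Lam M \<cdot> P = Lam (M \<cdot> lift P 0)"
| "Hole \<cdot> P = P"

text \<open>Simple types are assigned in Curry style; a context lists the types of the free variables.\<close>

datatype ty = Atom nat | Fun ty ty

inductive typing :: "ty list \<Rightarrow> lam \<Rightarrow> ty \<Rightarrow> bool" (\<open>_ \<turnstile> _ : _\<close> [50, 50, 50] 50) where
  "i < length \<Gamma> \<Longrightarrow> \<Gamma> \<turnstile> Var i : \<Gamma> ! i"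
| "\<sigma> # \<Gamma> \<turnstile> M : \<tau> \<Longrightarrow> \<Gamma> \<turnstile> Lam M : Fun \<sigma> \<tau>"
| "\<Gamma> \<turnstile> M : Fun \<sigma> \<tau> \<Longrightarrow> \<Gamma> \<turnstile> N : \<sigma> \<Longrightarrow> \<Gamma> \<turnstile> App M N : \<tau>"

inductive cbn :: "lam \<Rightarrow> lam \<Rightarrow> bool" where
  "cbn (App (Lam M) N) (subst M 0 N)"
| "cbn M M1 \<Longrightarrow> cbn (App M N) (App M1 N)"

inductive is_value :: "lam \<Rightarrow> bool" where
  "is_value (Var i)"
| "is_value (Lam M)"

inductive cbv :: "lam \<Rightarrow> lam \<Rightarrow> bool" where
  "is_value V \<Longrightarrow> cbv (App (Lam M) V) (subst M 0 V)"
| "cbv N N1 \<Longrightarrow> cbv (App M N) (App M N1)"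
| "is_value V \<Longrightarrow> cbv M M1 \<Longrightarrow> cbv (App M V) (App M1 V)"

text \<open>The p-variables are de Bruijn indices, bound by \<open>PLamXK\<close> (\<open>\<lambda>\<langle>x,k\<rangle>.u\<close>) and \<open>TLam\<close>
  (\<open>\<lambda>x.u\<close>). There is a single t-variable \<open>k\<close>, so it is a constant \<open>K\<close> that refers to the closest
  enclosing \<open>PLamXK\<close>, \<open>PLamK\<close> (\<open>\<lambda>k.u\<close>) or \<open>QLam\<close> (\<open>\<lambda>\<close>-bar \<open>k.u\<close>). \<open>Cut t p\<close> is \<open>t;p\<close> and
  \<open>QApp q t\<close> is \<open>q t\<close>.\<close>

datatype pterm = PVar nat | PLamXK eterm | PLamK eterm
and tterm = Star | K | TPair pterm tterm | TLam eterm
and qterm = QLam eterm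
and eterm = Cut tterm pterm | QApp qterm tterm

primrec lift_p :: "pterm \<Rightarrow> nat \<Rightarrow> pterm"
  and lift_t :: "tterm \<Rightarrow> nat \<Rightarrow> tterm"
  and lift_q :: "qterm \<Rightarrow> nat \<Rightarrow> qterm"
  and lift_e :: "eterm \<Rightarrow> nat \<Rightarrow> eterm" where
  "lift_p (PVar i) c = (if i < c then PVar i else PVar (Suc i))"
| "lift_p (PLamXK u) c = PLamXK (lift_e u (Suc c))"
| "lift_p (PLamK u) c = PLamK (lift_e u c)"
| "lift_t Star c = Star"
| "lift_t K c = K"
| "lift_t (TPair p t) c = TPair (lift_p p c) (lift_t t c)"
| "lift_t (TLam u) c = TLam (lift_e u (Suc c))"
| "lift_q (QLam u) c = QLam (lift_e u c)"
| "lift_e (Cut t p) c = Cut (lift_t t c) (lift_p p c)"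
| "lift_e (QApp q t) c = QApp (lift_q q c) (lift_t t c)"

text \<open>Substitution of a p-term for a p-variable. The p-terms and q-terms have no free occurrence of
  \<open>k\<close>, so there is no capture of \<open>k\<close> to avoid.\<close>

primrec subst_p :: "pterm \<Rightarrow> nat \<Rightarrow> pterm \<Rightarrow> pterm"
  and subst_t :: "tterm \<Rightarrow> nat \<Rightarrow> pterm \<Rightarrow> tterm"
  and subst_q :: "qterm \<Rightarrow> nat \<Rightarrow> pterm \<Rightarrow> qterm"
  and subst_e :: "eterm \<Rightarrow> nat \<Rightarrow> pterm \<Rightarrow> eterm" where
  "subst_p (PVar i) c r = (if i < c then PVar i else if i = c then r else PVar (i - 1))"
| "subst_p (PLamXK u) c r = PLamXK (subst_e u (Suc c) (lift_p r 0))"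
| "subst_p (PLamK u) c r = PLamK (subst_e u c r)"
| "subst_t Star c r = Star"
| "subst_t K c r = K"
| "subst_t (TPair p t) c r = TPair (subst_p p c r) (subst_t t c r)"
| "subst_t (TLam u) c r = TLam (subst_e u (Suc c) (lift_p r 0))"
| "subst_q (QLam u) c r = QLam (subst_e u c r)"
| "subst_e (Cut t p) c r = Cut (subst_t t c r) (subst_p p c r)"
| "subst_e (QApp q t) c r = QApp (subst_q q c r) (subst_t t c r)"

text \<open>Substitution of a t-term for \<open>k\<close>. It leaves p-terms and q-terms unchanged, as \<open>k\<close> is
  not free in them.\<close>

primrec substK_t :: "tterm \<Rightarrow> tterm \<Rightarrow> tterm"
  and substK_p :: "pterm \<Rightarrow> tterm \<Rightarrow> pterm"
  and substK_q :: "qterm \<Rightarrow> tterm \<Rightarrow> qterm"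
  and substK_e :: "eterm \<Rightarrow> tterm \<Rightarrow> eterm" where
  "substK_p (PVar i) s = PVar i"
| "substK_p (PLamXK u) s = PLamXK u"
| "substK_p (PLamK u) s = PLamK u"
| "substK_t Star s = Star"
| "substK_t K s = s"
| "substK_t (TPair p t) s = TPair (substK_p p s) (substK_t t s)"
| "substK_t (TLam u) s = TLam (substK_e u (lift_t s 0))"
| "substK_q (QLam u) s = QLam u"
| "substK_e (Cut t p) s = Cut (substK_t t s) (substK_p p s)"
| "substK_e (QApp q t) s = QApp (substK_q q s) (substK_t t s)"

text \<open>The t-closed terms are exactly those of the form \<open>t\<^sub>* = t[*/k]\<close>, \<open>u\<^sub>* = u[*/k]\<close>.\<close>

primrec tclosed_t :: "tterm \<Rightarrow> bool"
  and tclosed_p :: "pterm \<Rightarrow> bool"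
  and tclosed_q :: "qterm \<Rightarrow> bool"
  and tclosed_e :: "eterm \<Rightarrow> bool" where
  "tclosed_p (PVar i) \<longleftrightarrow> True"
| "tclosed_p (PLamXK u) \<longleftrightarrow> True"
| "tclosed_p (PLamK u) \<longleftrightarrow> True"
| "tclosed_t Star \<longleftrightarrow> True"
| "tclosed_t K \<longleftrightarrow> False"
| "tclosed_t (TPair p t) \<longleftrightarrow> tclosed_p p \<and> tclosed_t t"
| "tclosed_t (TLam u) \<longleftrightarrow> tclosed_e u"
| "tclosed_q (QLam u) \<longleftrightarrow> True"
| "tclosed_e (Cut t p) \<longleftrightarrow> tclosed_t t \<and> tclosed_p p"
| "tclosed_e (QApp q t) \<longleftrightarrow> tclosed_q q \<and> tclosed_t t"

text \<open>In the third rule the two substitutions may be done one after the other: \<open>k\<close> is not free in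
  \<open>p\<close>, and the bound p-variable does not occur in \<open>t\<close>.\<close>

inductive ptq :: "eterm \<Rightarrow> eterm \<Rightarrow> bool" where
  "ptq (Cut Star (PLamK u)) (substK_e u Star)"
| "tclosed_t t \<Longrightarrow> ptq (Cut (TPair p t) (PLamK u)) (substK_e u (TPair p t))"
| "tclosed_t t \<Longrightarrow> ptq (Cut (TPair p t) (PLamXK u)) (substK_e (subst_e u 0 p) t)"
| "tclosed_e u \<Longrightarrow> ptq (Cut (TLam u) p) (subst_e u 0 p)"
| "tclosed_t t \<Longrightarrow> ptq (QApp (QLam u) t) (substK_e u t)"

lemma size_substK_Star [termination_simp]:
  "size (substK_t t Star) = size t"
  "size (substK_p p Star) = size p"
  "size (substK_q q Star) = size q"
  "size (substK_e u Star) = size u"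
  by (induction t and p and q and u) auto

text \<open>Readback is only meaningful on t-closed terms; in particular its value on \<open>K\<close> is left
  unspecified.\<close>

fun readback_p :: "pterm \<Rightarrow> lam"
  and readback_t :: "tterm \<Rightarrow> lam"
  and readback_q :: "qterm \<Rightarrow> lam"
  and readback_e :: "eterm \<Rightarrow> lam" where
  "readback_p (PVar i) = Var i"
| "readback_p (PLamXK u) = Lam (readback_e (substK_e u Star))"
| "readback_p (PLamK u) = readback_e (substK_e u Star)"
| "readback_t Star = Hole"
| "readback_t (TPair p t) = readback_t t \<cdot> App Hole (readback_p p)"
| "readback_t (TLam u) = subst (readback_e u) 0 Hole"
| "readback_q (QLam u) = readback_e (substK_e u Star)"
| "readback_e (Cut t p) = readback_t t \<cdot> readback_p p"
| "readback_e (QApp q t) = readback_t t \<cdot> readback_q q"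

text \<open>The translations are defined on terms without \<open>Hole\<close> only.\<close>

primrec (nonexhaustive) trans_n :: "lam \<Rightarrow> pterm" where
  "trans_n (Var i) = PVar i"
| "trans_n (Lam M) = PLamXK (Cut K (trans_n M))"
| "trans_n (App M N) = PLamK (Cut (TPair (trans_n N) K) (trans_n M))"

primrec (nonexhaustive) trans_v :: "lam \<Rightarrow> qterm" where
  "trans_v (Var i) = QLam (Cut K (PVar i))"
| "trans_v (Lam M) = QLam (Cut K (PLamXK (QApp (trans_v M) K)))"
| "trans_v (App M N) =
     QLam (QApp (trans_v N) (TLam (QApp (lift_q (trans_v M) 0) (TPair (PVar 0) K))))"

end

theory Submission imports Defs begin

text \<open>Every state reachable from a translated term is a machine state: a translated term (or value)
  facing a stack of translated arguments and functions. Its readback is the term filled into the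
  evaluation context that the stack represents. A machine step either only moves the focus, which
  leaves the readback unchanged, or contracts the redex in focus, which is a single \<open>\<beta>\<close>-step
  because translation commutes with substitution.\<close>

section \<open>Substitution\<close>

text \<open>What typing provides: the translations are specified only on terms without
  \<open>Hole\<close>, and plugging into such a term changes nothing.\<close>

primrec hole_free :: "lam \<Rightarrow> bool" where
  "hole_free (Var i) \<longleftrightarrow> True"
| "hole_free (App M N) \<longleftrightarrow> hole_free M \<and> hole_free N"
| "hole_free (Lam M) \<longleftrightarrow> hole_free M"
| "hole_free Hole \<longleftrightarrow> False"

lemma typing_hole_free: "\<Gamma> \<turnstile> M : \<tau> \<Longrightarrow> hole_free M"
  by (induction rule: typing.induct) auto

lemma hole_free_lift [simp]: "hole_free (lift M c) \<longleftrightarrow> hole_free M"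
  by (induction M arbitrary: c) auto

lemma hole_free_subst: "hole_free M \<Longrightarrow> hole_free P \<Longrightarrow> hole_free (subst M c P)"
  by (induction M arbitrary: c P) auto

lemma plug_hole_free [simp]: "hole_free M \<Longrightarrow> M \<cdot> P = M"
  by (induction M arbitrary: P) auto

lemma subst_lift [simp]: "subst (lift M c) c P = M"
  by (induction M arbitrary: c P) auto

lemma size_lift [simp]: "size (lift M c) = size M"
  by (induction M arbitrary: c) auto

lemma subst_lift_ptq [simp]:
  "subst_p (lift_p p c) c r = p"
  "subst_t (lift_t t c) c r = t"
  "subst_q (lift_q q c) c r = q"
  "subst_e (lift_e u c) c r = u"
  by (induction p and t and q and u arbitrary: c r and c r and c r and c r) auto

lemma lift_lift_ptq:
  "i \<le> c \<Longrightarrow> lift_p (lift_p p i) (Suc c) = lift_p (lift_p p c) i"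
  "i \<le> c \<Longrightarrow> lift_t (lift_t t i) (Suc c) = lift_t (lift_t t c) i"
  "i \<le> c \<Longrightarrow> lift_q (lift_q q i) (Suc c) = lift_q (lift_q q c) i"
  "i \<le> c \<Longrightarrow> lift_e (lift_e u i) (Suc c) = lift_e (lift_e u c) i"
  by (induction p and t and q and u arbitrary: i c and i c and i c and i c) auto

text \<open>For applications in \<open>trans_v\<close>, where the translated function is lifted past
  the binder of \<open>TLam\<close>.\<close>

lemma subst_lift_commute_ptq:
  "i \<le> c \<Longrightarrow> subst_p (lift_p p i) (Suc c) (lift_p r i) = lift_p (subst_p p c r) i"
  "i \<le> c \<Longrightarrow> subst_t (lift_t t i) (Suc c) (lift_p r i) = lift_t (subst_t t c r) i"
  "i \<le> c \<Longrightarrow> subst_q (lift_q q i) (Suc c) (lift_p r i) = lift_q (subst_q q c r) i"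
  "i \<le> c \<Longrightarrow> subst_e (lift_e u i) (Suc c) (lift_p r i) = lift_e (subst_e u c r) i"
  by (induction p and t and q and u arbitrary: i c r and i c r and i c r and i c r)
    (auto simp: lift_lift_ptq(1)[of 0, symmetric])

lemma substK_p [simp]: "substK_p p s = p"
  by (cases p) auto

lemma substK_q [simp]: "substK_q q s = q"
  by (cases q) auto

section \<open>Call-by-Name\<close>

lemma lift_trans_n: "hole_free M \<Longrightarrow> lift_p (trans_n M) c = trans_n (lift M c)"
  by (induction M arbitrary: c) auto

text \<open>A variable translates to itself, so any translated term may replace it, value or
  not.\<close>

lemma subst_trans_n:
  "hole_free M \<Longrightarrow> hole_free P \<Longrightarrow> subst_p (trans_n M) c (trans_n P) = trans_n (subst M c P)"
  by (induction M arbitrary: c P) (auto simp: lift_trans_n)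

lemma readback_trans_n: "hole_free M \<Longrightarrow> readback_p (trans_n M) = M"
  by (induction M) auto

text \<open>The stack of a Krivine machine, with the argument consumed first at the head of the
  list.\<close>

primrec stack_n :: "lam list \<Rightarrow> tterm" where
  "stack_n [] = Star"
| "stack_n (N # Ns) = TPair (trans_n N) (stack_n Ns)"

lemma plug_foldl_App: "list_all hole_free Ns \<Longrightarrow> foldl App A Ns \<cdot> P = foldl App (A \<cdot> P) Ns"
  by (induction Ns arbitrary: A) auto

lemma readback_stack_n: "list_all hole_free Ns \<Longrightarrow> readback_t (stack_n Ns) = foldl App Hole Ns"
  by (induction Ns) (auto simp: readback_trans_n plug_foldl_App)

lemma cbn_foldl_App: "cbn M M' \<Longrightarrow> cbn (foldl App M Ns) (foldl App M' Ns)"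
  by (induction Ns arbitrary: M M') (auto intro: cbn.intros)

text \<open>Pairing each state with its term keeps readback out of the step-by-step
  argument.\<close>

inductive state_n :: "eterm \<Rightarrow> lam \<Rightarrow> bool" where
  "hole_free M \<Longrightarrow> list_all hole_free Ns \<Longrightarrow>
    state_n (Cut (stack_n Ns) (trans_n M)) (foldl App M Ns)"

lemma readback_state_n: "state_n u L \<Longrightarrow> readback_e u = L"
  by (auto elim!: state_n.cases simp: readback_trans_n readback_stack_n plug_foldl_App)

lemma state_n_step:
  assumes "state_n u L" "ptq u u'"
  shows "\<exists>L'. state_n u' L' \<and> cbn\<^sup>*\<^sup>* L L'"
  using assms(1)
proof cases
  case (1 M Ns)
  note step = assms(2)[unfolded 1(1)]
  show ?thesis
  proof (cases M)
    case (Var i)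
    then show ?thesis using step by (cases Ns) (auto elim: ptq.cases)
  next
    case (App A B)
    \<comment> \<open>\<open>Star\<close> and \<open>TPair\<close> have separate rules against
      \<open>PLamK\<close>, but both put the whole stack for \<open>K\<close>.\<close>
    then have "u' = Cut (stack_n (B # Ns)) (trans_n A)"
      using step by (cases Ns) (auto elim: ptq.cases)
    moreover have "state_n (Cut (stack_n (B # Ns)) (trans_n A)) (foldl App A (B # Ns))"
      using 1 App by (intro state_n.intros) auto
    ultimately show ?thesis using 1 App by auto
  next
    case (Lam A)
    \<comment> \<open>No rule fires on \<open>Star\<close> against \<open>PLamXK\<close>, so an
      argument is available.\<close>
    then obtain P Ps where Ns: "Ns = P # Ps"
      using step by (cases Ns) (auto elim: ptq.cases)
    then have "u' = Cut (stack_n Ps) (trans_n (subst A 0 P))"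
      using step 1 Lam by (auto elim!: ptq.cases simp: subst_trans_n)
    moreover have
      "state_n (Cut (stack_n Ps) (trans_n (subst A 0 P))) (foldl App (subst A 0 P) Ps)"
      using 1 Lam Ns by (intro state_n.intros) (auto intro: hole_free_subst)
    moreover have "cbn L (foldl App (subst A 0 P) Ps)"
      using 1 Lam Ns by (auto intro: cbn_foldl_App cbn.intros)
    ultimately show ?thesis by auto
  next
    case Hole
    then show ?thesis using 1 by simp
  qed
qed

section \<open>Call-by-Value\<close>

text \<open>\<open>trans_v\<close> yields q-terms, while substitution and pairs take p-terms; this
  is the p-term that the translation of a value hands to \<open>K\<close>.\<close>

fun trans_value :: "lam \<Rightarrow> pterm" where
  "trans_value (Var i) = PVar i"
| "trans_value (Lam M) = PLamXK (QApp (trans_v M) K)"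
| "trans_value _ = undefined"

lemma trans_v_value: "is_value V \<Longrightarrow> trans_v V = QLam (Cut K (trans_value V))"
  by (cases rule: is_value.cases) auto

lemma is_value_lift [simp]: "is_value V \<Longrightarrow> is_value (lift V c)"
  by (auto elim!: is_value.cases intro: is_value.intros)

lemma lift_trans_v: "hole_free M \<Longrightarrow> lift_q (trans_v M) c = trans_v (lift M c)"
proof (induction M arbitrary: c)
  case (App M N)
  then show ?case by (simp add: lift_lift_ptq(3) flip: App.IH)
qed auto

lemma lift_trans_value:
  "hole_free V \<Longrightarrow> is_value V \<Longrightarrow> lift_p (trans_value V) c = trans_value (lift V c)"
  by (auto elim!: is_value.cases simp: lift_trans_v)

text \<open>The variable case needs a value: \<open>QLam (Cut K (PVar c))\<close> becomes
  \<open>QLam (Cut K (trans_value V))\<close>, which is \<open>trans_v V\<close>.\<close>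

lemma subst_trans_v:
  "hole_free M \<Longrightarrow> hole_free V \<Longrightarrow> is_value V \<Longrightarrow>
    subst_q (trans_v M) c (trans_value V) = trans_v (subst M c V)"
proof (induction M arbitrary: c V)
  case (App M N)
  then show ?case by (simp add: subst_lift_commute_ptq(3))
qed (auto simp: lift_trans_value trans_v_value)

lemma readback_trans_v: "hole_free M \<Longrightarrow> readback_q (trans_v M) = M"
\<comment> \<open>For \<open>App M N\<close> the readback meets the translation of
  \<open>lift M 0\<close>, which is no subterm but has the size of \<open>M\<close>.\<close>
proof (induction M rule: measure_induct_rule[of size])
  case (less M)
  then show ?case by (cases M) (auto simp: lift_trans_v)
qed

lemma readback_trans_value: "hole_free V \<Longrightarrow> is_value V \<Longrightarrow> readback_p (trans_value V) = V"
  by (auto elim!: is_value.cases simp: readback_trans_v)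

text \<open>\<open>FunFrame M\<close> is the context \<open>M \<box>\<close> and \<open>ValueFrame V\<close> is \<open>\<box> V\<close>; the head of a list of
  frames is the innermost one.\<close>

datatype frame = FunFrame lam | ValueFrame lam

fun frame_ok :: "frame \<Rightarrow> bool" where
  "frame_ok (FunFrame M) \<longleftrightarrow> hole_free M"
| "frame_ok (ValueFrame V) \<longleftrightarrow> hole_free V \<and> is_value V"

fun lift_frame :: "frame \<Rightarrow> nat \<Rightarrow> frame" where
  "lift_frame (FunFrame M) c = FunFrame (lift M c)"
| "lift_frame (ValueFrame V) c = ValueFrame (lift V c)"

fun fill :: "frame list \<Rightarrow> lam \<Rightarrow> lam" where
  "fill [] P = P"
| "fill (FunFrame M # S) P = fill S (App M P)"
| "fill (ValueFrame V # S) P = fill S (App P V)"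

text \<open>The clause for \<open>FunFrame\<close> is the \<open>TLam\<close> from the translation
  of an application, with the outer stack, lifted under the binder, for \<open>K\<close>.\<close>

fun stack_v :: "frame list \<Rightarrow> tterm" where
  "stack_v [] = Star"
| "stack_v (FunFrame M # S) =
    TLam (QApp (lift_q (trans_v M) 0) (TPair (PVar 0) (lift_t (stack_v S) 0)))"
| "stack_v (ValueFrame V # S) = TPair (trans_value V) (stack_v S)"

lemma frame_ok_lift [simp]: "frame_ok F \<Longrightarrow> frame_ok (lift_frame F c)"
  by (cases F) auto

lemma list_all_frame_ok_lift [simp]:
  "list_all frame_ok S \<Longrightarrow> list_all frame_ok (map (\<lambda>F. lift_frame F c) S)"
  by (induction S) auto

lemma lift_stack_v:
  "list_all frame_ok S \<Longrightarrow> lift_t (stack_v S) c = stack_v (map (\<lambda>F. lift_frame F c) S)"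
proof (induction S arbitrary: c rule: stack_v.induct)
  case (2 M S)
  then show ?case by (simp add: lift_lift_ptq lift_trans_v[symmetric] flip: "2.IH")
qed (auto simp: lift_trans_value)

lemma plug_fill: "list_all frame_ok S \<Longrightarrow> fill S A \<cdot> P = fill S (A \<cdot> P)"
  by (induction S A rule: fill.induct) auto

text \<open>Lifted frames avoid index \<open>c\<close>, so only the focus is affected; this undoes
  the lifting under \<open>TLam\<close> when a stack is read back.\<close>

lemma subst_fill_lift:
  "subst (fill (map (\<lambda>F. lift_frame F c) S) A) c P = fill S (subst A c P)"
proof (induction S arbitrary: A)
  case (Cons F S)
  then show ?case by (cases F) auto
qed simp

lemma readback_stack_v: "list_all frame_ok S \<Longrightarrow> readback_t (stack_v S) = fill S Hole"
proof (induction S rule: measure_induct_rule[of length])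
  case (less S)
  show ?case
  proof (cases S rule: stack_v.cases)
    case (2 M S')
    let ?S = "map (\<lambda>F. lift_frame F 0) S'"
    have "readback_t (stack_v ?S) = fill ?S Hole" using less 2 by simp
    then show ?thesis using less.prems 2
      by (simp add: lift_stack_v lift_trans_v readback_trans_v plug_fill subst_fill_lift)
  qed (use less in \<open>auto simp: readback_trans_value plug_fill\<close>)
qed

text \<open>Arguments reduce under any function, functions only against a value;
  \<open>frame_ok\<close> supplies that value.\<close>

lemma cbv_fill: "list_all frame_ok S \<Longrightarrow> cbv M M' \<Longrightarrow> cbv (fill S M) (fill S M')"
proof (induction S M arbitrary: M' rule: fill.induct)
  case (2 M S P)
  then show ?case by (simp add: cbv.intros)
qed (auto intro: cbv.intros)

inductive state_v :: "eterm \<Rightarrow> lam \<Rightarrow> bool" where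
  eval: "hole_free M \<Longrightarrow> list_all frame_ok S \<Longrightarrow>
    state_v (QApp (trans_v M) (stack_v S)) (fill S M)"
| return: "hole_free V \<Longrightarrow> is_value V \<Longrightarrow> list_all frame_ok S \<Longrightarrow>
    state_v (Cut (stack_v S) (trans_value V)) (fill S V)"

lemma readback_state_v: "state_v u L \<Longrightarrow> readback_e u = L"
  by (auto elim!: state_v.cases
      simp: readback_trans_v readback_trans_value readback_stack_v plug_fill)

lemma state_v_step:
  assumes "state_v u L" "ptq u u'"
  shows "\<exists>L'. state_v u' L' \<and> cbv\<^sup>*\<^sup>* L L'"
  using assms(1)
proof cases
  case (eval M S)
  note step = assms(2)[unfolded eval(1)]
  \<comment> \<open>Only the focus moves: an application pushes its function and turns to the
    argument, a value switches to \<open>return\<close>.\<close>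
  have "state_v u' L"
  proof (cases M)
    case (App A B)
    then have "u' = QApp (trans_v B) (stack_v (FunFrame A # S))"
      using step by (auto elim!: ptq.cases)
    then show ?thesis using eval App state_v.eval[of B "FunFrame A # S"] by simp
  next
    case Hole
    then show ?thesis using eval by simp
  qed (use eval step state_v.return[of M S] in \<open>auto elim!: ptq.cases simp: is_value.intros\<close>)
  then show ?thesis by blast
next
  case (return V S)
  note step = assms(2)[unfolded return(1)]
  show ?thesis
  proof (cases S rule: stack_v.cases)
    case 1
    then show ?thesis using step \<open>is_value V\<close> by (auto elim!: ptq.cases is_value.cases)
  next
    case (2 M S')
    \<comment> \<open>Substituting for index 0 cancels the lifts; the value is stored while its
      function is evaluated, and the filled term stays the same.\<close>
    then have "u' = QApp (trans_v M) (stack_v (ValueFrame V # S'))"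
      using step \<open>is_value V\<close> by (auto elim!: ptq.cases is_value.cases)
    then show ?thesis using return 2 state_v.eval[of M "ValueFrame V # S'"] by auto
  next
    case (3 W S')
    \<comment> \<open>A variable facing an argument is stuck, so the step contracts
      \<open>App (Lam A) W\<close>.\<close>
    then obtain A where V: "V = Lam A"
      using step \<open>is_value V\<close> by (auto elim!: ptq.cases is_value.cases)
    then have "u' = QApp (trans_v (subst A 0 W)) (stack_v S')"
      using step return 3 by (auto elim!: ptq.cases simp: subst_trans_v)
    moreover have "state_v (QApp (trans_v (subst A 0 W)) (stack_v S')) (fill S' (subst A 0 W))"
      using return 3 V by (intro state_v.eval) (auto intro: hole_free_subst)
    moreover have "cbv L (fill S' (subst A 0 W))"
      using return 3 V by (auto intro: cbv_fill cbv.intros)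
    ultimately show ?thesis by auto
  qed
qed

section \<open>Simulation\<close>

text \<open>Allowing zero steps of \<open>s\<close> absorbs the moves of focus.\<close>

lemma simulation_rtranclp:
  assumes "\<And>u u' L. R u L \<Longrightarrow> r u u' \<Longrightarrow> \<exists>L'. R u' L' \<and> s\<^sup>*\<^sup>* L L'"
    and "r\<^sup>*\<^sup>* u u'" "R u L"
  shows "\<exists>L'. R u' L' \<and> s\<^sup>*\<^sup>* L L'"
  using assms(2,3)
proof (induction rule: rtranclp_induct)
  case base
  then show ?case by blast
next
  case (step v w)
  then obtain L1 where L1: "R v L1" "s\<^sup>*\<^sup>* L L1" by blast
  obtain L2 where "R w L2" "s\<^sup>*\<^sup>* L1 L2" using assms(1)[OF L1(1) step(2)] by blast
  then show ?case using rtranclp_trans[OF L1(2)] by blast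
qed

theorem theorem4:
  fixes M :: lam and \<Gamma> :: "ty list" and \<tau> :: ty
  assumes "\<Gamma> \<turnstile> M : \<tau>"
  shows "(\<forall>u. tclosed_e u \<longrightarrow> ptq\<^sup>*\<^sup>* (Cut Star (trans_n M)) u \<longrightarrow> cbn\<^sup>*\<^sup>* M (readback_e u)) \<and>
         (\<forall>u. tclosed_e u \<longrightarrow> ptq\<^sup>*\<^sup>* (QApp (trans_v M) Star) u \<longrightarrow> cbv\<^sup>*\<^sup>* M (readback_e u))"
proof (intro conjI allI impI)
  have M: "hole_free M" using assms by (rule typing_hole_free)
  {
    fix u assume steps: "ptq\<^sup>*\<^sup>* (Cut Star (trans_n M)) u"
    have "state_n (Cut Star (trans_n M)) M" using state_n.intros[of M "[]"] M by simp
    with state_n_step have "\<exists>L. state_n u L \<and> cbn\<^sup>*\<^sup>* M L"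
      by (rule simulation_rtranclp[OF _ steps])
    then obtain L where "state_n u L" "cbn\<^sup>*\<^sup>* M L" by blast
    then show "cbn\<^sup>*\<^sup>* M (readback_e u)" by (simp add: readback_state_n)
  next
    fix u assume steps: "ptq\<^sup>*\<^sup>* (QApp (trans_v M) Star) u"
    have "state_v (QApp (trans_v M) Star) M" using state_v.eval[of M "[]"] M by simp
    with state_v_step have "\<exists>L. state_v u L \<and> cbv\<^sup>*\<^sup>* M L"
      by (rule simulation_rtranclp[OF _ steps])
    then obtain L where "state_v u L" "cbv\<^sup>*\<^sup>* M L" by blast
    then show "cbv\<^sup>*\<^sup>* M (readback_e u)" by (simp add: readback_state_v)
  }
qed

end
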